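(* (Generalised Wallman posets are dual to relatively compact subbases of locally compact $T_1$ spaces.) Precisely: (1) Let $(\mathbb{P},\leq,\Theta)$ be a generalised Wallman poset. Then the spectrum $\widehat\Theta$ is a locally compact $T_1$ space, $(\widehat\Theta_p)_{p\in\mathbb{P}}$ is a subbasis of $\widehat\Theta$ consisting of relatively compact sets, for all $p,q\in\mathbb{P}$ we have $p\leq q\Leftrightarrow\widehat\Theta_p\subseteq\widehat\Theta_q$, and for all $C\subseteq\mathbb{P}$ we have $C\in\Theta\Leftrightarrow\widehat\Theta=\bigcup_{c\in C}\widehat\Theta_c$. (2) Conversely, let $X$ be a $T_1$ space, let $\mathbb{P}\subseteq\mathcal{O}(X)$ be a subbasis of $X$ consisting of relatively compact sets, let $\leq\ =\ \subseteq$ on $\mathbb{P}$ and let $\Theta=\mathcal{C}_X(\mathbb{P})=\{C\subseteq\mathbb{P}:X\subseteq\bigcup C\}$. Then $(\mathbb{P},\leq,\Theta)$ is a generalised Wallman poset and $\widehat\Theta$ is homeomorphic to $X$.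
   Context: A set is relatively compact if its closure is compact. A space is called locally compact if it has a basis of relatively compact open sets. $\mathcal{O}(X)$ denotes the open sets of $X$; $\mathbb{P}\subseteq\mathcal{O}(X)$ is a subbasis if the finite intersections (including the empty one, equal to $X$) of elements of $\mathbb{P}$ form a basis. Let $(\mathbb{P},\leq)$ be a poset and $\Theta\subseteq\mathcal{P}(\mathbb{P})$ (power set). For $R,S\subseteq\mathbb{P}$, $R\leq S$ ($R$ refines $S$) means $\forall r\in R\ \exists s\in S\ (r\leq s)$, and $\Theta^\leq=\{D\subseteq\mathbb{P}:\exists C\in\Theta\ (C\leq D)\}$. $\mathcal{F}(\mathbb{P})$ is the set of finite subsets of $\mathbb{P}$ (including $\emptyset$). Spectrum: $R\subseteq\mathbb{P}$ is $\Theta$-Cauchy if $C\cap R\neq\emptyset$ for all $C\in\Theta$; $\Theta$-round if for every $r\in R$ there is $C\in\Theta$ with $c\leq r$ for all $c\in C\cap R$. $\widehat\Theta$ is the set of all $\Theta$-round $\Theta$-Cauchy ($\leq$-)up-sets $R\subseteq\mathbb{P}$, with the topology having subbasis $(\widehat\Theta_p)_{p\in\mathbb{P}}$, where $\widehat\Theta_p=\{R\in\widehat\Theta:p\in R\}$. Near subsets: $S\subseteq\mathbb{P}$ is $\Theta^\leq$-near if there is $D\subseteq\mathbb{P}$ with $D\notin\Theta^\leq$ and $D\cup\{s\}\in\Theta^\leq$ for all $s\in S$. Restrictions: for $S\subseteq\mathbb{P}$, $\mathcal{F}^S_\Theta=\{F\in\mathcal{F}(\mathbb{P}):F\cup S\text{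 is not }\Theta^\leq\text{-near}\}$; a set $D\subseteq\mathbb{P}$ is $\mathcal{F}^S_\Theta$-Cauchy if $D\cap F\neq\emptyset$ for all $F\in\mathcal{F}^S_\Theta$; and $\Theta|S=\{C\subseteq\mathbb{P}: C\cup D\in\Theta^\leq\text{ for every }\mathcal{F}^S_\Theta\text{-Cauchy }D\subseteq\mathbb{P}\}$. For $p\in\mathbb{P}$, $\Theta|p=\Theta|\{p\}$. The preorder $\leq_\Theta$ on $\mathbb{P}$: $p\leq_\Theta q$ iff for all $R\subseteq\mathbb{P}$, $R\cup\{p\}\in\Theta$ implies $R\cup\{q\}\in\Theta$. $(\mathbb{P},\leq,\Theta)$ is a generalised Wallman poset if: (i) for all $p\in\mathbb{P}$, $\Theta|p\cap\mathcal{F}(\mathbb{P})$ is coinitial in $\Theta|p$, i.e. every $C\in\Theta|p$ is refined by some finite $F\in\Theta|p$; and (ii) $\Theta=\Theta|\emptyset$ and $\leq\ =\ \leq_\Theta$. *)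

theory Defs
  imports "HOL-Analysis.Analysis"
begin

section \<open>Topological notions\<close>

definition basis_of :: "'a topology \<Rightarrow> 'a set set \<Rightarrow> bool" where
  "basis_of X B \<longleftrightarrow> openin X = arbitrary union_of (\<lambda>U. U \<in> B)"

text \<open>Relativising to the carrier makes the empty intersection equal to the whole space
  (and not to \<^term>\<open>UNIV\<close>); it has no effect on nonempty intersections of open sets.\<close>

definition subbasis_of :: "'a topology \<Rightarrow> 'a set set \<Rightarrow> bool" where
  "subbasis_of X B \<longleftrightarrow>
     (\<forall>U\<in>B. openin X U) \<and>
     basis_of X (Collect (finite intersection_of (\<lambda>U. U \<in> B) relative_to topspace X))"

definition relatively_compactin :: "'a topology \<Rightarrow> 'a set \<Rightarrow> bool" where
  "relatively_compactin X S \<longleftrightarrow> S \<subseteq> topspace X \<and> compactin X (X closure_of S)"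

text \<open>Without the Hausdorff axiom this is stronger than the library's
  \<^const>\<open>locally_compact_space\<close>, which only asks for compact neighbourhoods (whose
  closures need not be compact).\<close>

definition loc_rel_compact_space :: "'a topology \<Rightarrow> bool" where
  "loc_rel_compact_space X \<longleftrightarrow>
     (\<exists>B. basis_of X B \<and> (\<forall>U\<in>B. relatively_compactin X U))"

definition covers_of :: "'a topology \<Rightarrow> 'a set set \<Rightarrow> 'a set set set" where
  "covers_of X P = {C. C \<subseteq> P \<and> topspace X \<subseteq> \<Union>C}"


section \<open>Families of subsets of a poset\<close>

text \<open>Throughout, a poset is given by a carrier \<open>P\<close> and a relation \<open>le\<close>, of which only the
  restriction to \<open>P\<close> matters.\<close>

definition poset_on :: "'a set \<Rightarrow> ('a \<Rightarrow> 'a \<Rightarrow> bool) \<Rightarrow> bool" where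
  "poset_on P le \<longleftrightarrow> reflp_on P le \<and> antisymp_on P le \<and> transp_on P le"

definition refines :: "('a \<Rightarrow> 'a \<Rightarrow> bool) \<Rightarrow> 'a set \<Rightarrow> 'a set \<Rightarrow> bool" where
  "refines le R S \<longleftrightarrow> (\<forall>r\<in>R. \<exists>s\<in>S. le r s)"

definition ref_closure :: "'a set \<Rightarrow> ('a \<Rightarrow> 'a \<Rightarrow> bool) \<Rightarrow> 'a set set \<Rightarrow> 'a set set" where
  "ref_closure P le \<Theta> = {D. D \<subseteq> P \<and> (\<exists>C\<in>\<Theta>. refines le C D)}"

definition cauchy_for :: "'a set set \<Rightarrow> 'a set \<Rightarrow> bool" where
  "cauchy_for \<Theta> R \<longleftrightarrow> (\<forall>C\<in>\<Theta>. C \<inter> R \<noteq> {})"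

definition round_for :: "('a \<Rightarrow> 'a \<Rightarrow> bool) \<Rightarrow> 'a set set \<Rightarrow> 'a set \<Rightarrow> bool" where
  "round_for le \<Theta> R \<longleftrightarrow> (\<forall>r\<in>R. \<exists>C\<in>\<Theta>. \<forall>c \<in> C \<inter> R. le c r)"

definition up_set_in :: "'a set \<Rightarrow> ('a \<Rightarrow> 'a \<Rightarrow> bool) \<Rightarrow> 'a set \<Rightarrow> bool" where
  "up_set_in P le R \<longleftrightarrow> R \<subseteq> P \<and> (\<forall>r\<in>R. \<forall>q\<in>P. le r q \<longrightarrow> q \<in> R)"


section \<open>The spectrum\<close>

definition spectrum_points :: "'a set \<Rightarrow> ('a \<Rightarrow> 'a \<Rightarrow> bool) \<Rightarrow> 'a set set \<Rightarrow> 'a set set" where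
  "spectrum_points P le \<Theta> =
     {R. up_set_in P le R \<and> cauchy_for \<Theta> R \<and> round_for le \<Theta> R}"

definition spectrum_sub ::
  "'a set \<Rightarrow> ('a \<Rightarrow> 'a \<Rightarrow> bool) \<Rightarrow> 'a set set \<Rightarrow> 'a \<Rightarrow> 'a set set" where
  "spectrum_sub P le \<Theta> p = {R \<in> spectrum_points P le \<Theta>. p \<in> R}"

definition spectrum :: "'a set \<Rightarrow> ('a \<Rightarrow> 'a \<Rightarrow> bool) \<Rightarrow> 'a set set \<Rightarrow> 'a set topology" where
  "spectrum P le \<Theta> =
     topology (arbitrary union_of
       (finite intersection_of (\<lambda>U. U \<in> spectrum_sub P le \<Theta> ` P)
          relative_to spectrum_points P le \<Theta>))"

lemma topspace_spectrum: "topspace (spectrum P le \<Theta>) = spectrum_points P le \<Theta>"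
  unfolding spectrum_def by (rule topspace_subbase)

lemma openin_spectrum:
  "openin (spectrum P le \<Theta>) =
     arbitrary union_of
       (finite intersection_of (\<lambda>U. U \<in> spectrum_sub P le \<Theta> ` P)
          relative_to spectrum_points P le \<Theta>)"
  unfolding spectrum_def by (rule topology_inverse'[OF istopology_subbase])


section \<open>Generalised Wallman posets\<close>

definition near_subset :: "'a set \<Rightarrow> ('a \<Rightarrow> 'a \<Rightarrow> bool) \<Rightarrow> 'a set set \<Rightarrow> 'a set \<Rightarrow> bool" where
  "near_subset P le \<Theta> S \<longleftrightarrow>
     (\<exists>D. D \<subseteq> P \<and> D \<notin> ref_closure P le \<Theta> \<and>
          (\<forall>s\<in>S. D \<union> {s} \<in> ref_closure P le \<Theta>))"

definition far_finite ::
  "'a set \<Rightarrow> ('a \<Rightarrow> 'a \<Rightarrow> bool) \<Rightarrow> 'a set set \<Rightarrow> 'a set \<Rightarrow> 'a set set" where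
  "far_finite P le \<Theta> S = {F. finite F \<and> F \<subseteq> P \<and> \<not> near_subset P le \<Theta> (F \<union> S)}"

definition restriction ::
  "'a set \<Rightarrow> ('a \<Rightarrow> 'a \<Rightarrow> bool) \<Rightarrow> 'a set set \<Rightarrow> 'a set \<Rightarrow> 'a set set" where
  "restriction P le \<Theta> S =
     {C. C \<subseteq> P \<and>
         (\<forall>D. D \<subseteq> P \<and> cauchy_for (far_finite P le \<Theta> S) D \<longrightarrow> C \<union> D \<in> ref_closure P le \<Theta>)}"

definition theta_le :: "'a set \<Rightarrow> 'a set set \<Rightarrow> 'a \<Rightarrow> 'a \<Rightarrow> bool" where
  "theta_le P \<Theta> p q \<longleftrightarrow> (\<forall>R. R \<subseteq> P \<longrightarrow> R \<union> {p} \<in> \<Theta> \<longrightarrow> R \<union> {q} \<in> \<Theta>)"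

definition generalised_wallman_poset ::
  "'a set \<Rightarrow> ('a \<Rightarrow> 'a \<Rightarrow> bool) \<Rightarrow> 'a set set \<Rightarrow> bool" where
  "generalised_wallman_poset P le \<Theta> \<longleftrightarrow>
     poset_on P le \<and>
     \<Theta> \<subseteq> Pow P \<and>
     (\<forall>p\<in>P. \<forall>C \<in> restriction P le \<Theta> {p}.
        \<exists>F \<in> restriction P le \<Theta> {p}. finite F \<and> refines le F C) \<and>
     \<Theta> = restriction P le \<Theta> {} \<and>
     (\<forall>p\<in>P. \<forall>q\<in>P. le p q \<longleftrightarrow> theta_le P \<Theta> p q)"

end

theory Submission
  imports Defs
begin

text \<open>
  The bridge between the two halves is the following situation: a \<open>T\<^sub>1\<close> space \<open>X\<close> has a subbasis
  indexed by \<open>P\<close>, the order on \<open>P\<close> is inclusion of the subbasic sets, and \<open>\<Theta>\<close> consists of the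
  subsets of \<open>P\<close> whose sets cover \<open>X\<close>. There everything abstract has a topological meaning. As the
  space is \<open>T\<^sub>1\<close>, the indices of the subbasic sets that miss a given point form a maximal
  non-cover. These maximal non-covers show that a set of indices is near iff its subbasic sets have a
  common point, that \<open>\<Theta>|S\<close> consists of the families covering the closure of the intersection of the
  sets indexed by \<open>S\<close> (lemma \<open>restriction_eq\<close>), and that \<open>\<le>\<^sub>\<Theta>\<close> is inclusion. Hence compactness of the closures of the
  subbasic sets says exactly that the finite members of each \<open>\<Theta>|p\<close> are coinitial. Moreover the
  complement of a round Cauchy up-set is not a cover, so such a set contains the indices of all
  subbasic neighbourhoods of some point, and roundness forbids anything else; this identifies the
  spectrum with \<open>X\<close>.

  The second half of the theorem is this situation for an actual subbasis. For the first half one has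
  to produce the situation: the points of the spectrum are precisely the complements of the maximal
  non-covers, so one needs enough of the latter (lemma \<open>noncover_extends\<close>). Zorn's lemma does not
  apply to \<open>\<Theta>\<close>, whose covers need not have finite subcovers, but it applies to \<open>\<Theta>|p\<close>. Two
  remarks make this work: \<open>\<Theta> = \<Theta>|\<emptyset>\<close> allows one to start with a non-cover meeting every far finite
  set, and such a family is automatically a non-member of \<open>\<Theta>|p\<close> for each \<open>p\<close> outside of it; and a
  maximal non-member of \<open>\<Theta>|p\<close> is also maximal among the non-covers.
\<close>

section \<open>Subbases and relative compactness\<close>

lemma subbasis_of_alt:
  "subbasis_of X B \<longleftrightarrow>
     (\<forall>U\<in>B. openin X U) \<and>
     (\<forall>U x. openin X U \<and> x \<in> U \<longrightarrow>
        (\<exists>F. finite F \<and> F \<subseteq> B \<and> x \<in> \<Inter>F \<and> topspace X \<inter> \<Inter>F \<subseteq> U))"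
  (is "?l \<longleftrightarrow> ?o \<and> ?r")
proof -
  have base: "(finite intersection_of (\<lambda>U. U \<in> B) relative_to topspace X) V \<longleftrightarrow>
      (\<exists>F. finite F \<and> F \<subseteq> B \<and> V = topspace X \<inter> \<Inter>F)" for V
    by (auto simp: relative_to_def intersection_of_def)
  have opn: "openin X (topspace X \<inter> \<Inter>F)" if "?o" "finite F" "F \<subseteq> B" for F
    using that(2,3)
  proof (induction F rule: finite_induct)
    case empty
    then show ?case by simp
  next
    case (insert U F)
    then have "openin X U" "openin X (topspace X \<inter> \<Inter>F)" using \<open>?o\<close> by auto
    then have "openin X (U \<inter> (topspace X \<inter> \<Inter>F))" by (rule openin_Int)
    then show ?case by (simp add: Int_left_commute)
  qed
  have "basis_of X (Collect (finite intersection_of (\<lambda>U. U \<in> B) relative_to topspace X)) \<longleftrightarrow> ?r"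
    if "?o"
    unfolding basis_of_def openin_topology_base_unique mem_Collect_eq base
  proof
    assume L: "(\<forall>V. (\<exists>F. finite F \<and> F \<subseteq> B \<and> V = topspace X \<inter> \<Inter>F) \<longrightarrow> openin X V) \<and>
      (\<forall>U x. openin X U \<and> x \<in> U \<longrightarrow>
        (\<exists>V. (\<exists>F. finite F \<and> F \<subseteq> B \<and> V = topspace X \<inter> \<Inter>F) \<and> x \<in> V \<and> V \<subseteq> U))"
    show ?r
    proof (intro allI impI)
      fix U x assume "openin X U \<and> x \<in> U"
      then have "\<exists>V. (\<exists>F. finite F \<and> F \<subseteq> B \<and> V = topspace X \<inter> \<Inter>F) \<and> x \<in> V \<and> V \<subseteq> U"
        by (rule L[THEN conjunct2, rule_format])
      then show "\<exists>F. finite F \<and> F \<subseteq> B \<and> x \<in> \<Inter>F \<and> topspace X \<inter> \<Inter>F \<subseteq> U" by blast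
    qed
  next
    assume r: ?r
    have nbh: "\<exists>V. (\<exists>F. finite F \<and> F \<subseteq> B \<and> V = topspace X \<inter> \<Inter>F) \<and> x \<in> V \<and> V \<subseteq> U"
      if U: "openin X U" "x \<in> U" for U x
    proof -
      obtain F where F: "finite F" "F \<subseteq> B" "x \<in> \<Inter>F" "topspace X \<inter> \<Inter>F \<subseteq> U"
        using r U by meson
      moreover have "x \<in> topspace X" using U openin_subset by blast
      ultimately show ?thesis by blast
    qed
    then show "(\<forall>V. (\<exists>F. finite F \<and> F \<subseteq> B \<and> V = topspace X \<inter> \<Inter>F) \<longrightarrow> openin X V) \<and>
      (\<forall>U x. openin X U \<and> x \<in> U \<longrightarrow>
        (\<exists>V. (\<exists>F. finite F \<and> F \<subseteq> B \<and> V = topspace X \<inter> \<Inter>F) \<and> x \<in> V \<and> V \<subseteq> U))"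
    proof (intro conjI allI impI)
      fix V assume "\<exists>F. finite F \<and> F \<subseteq> B \<and> V = topspace X \<inter> \<Inter>F"
      then show "openin X V" using opn[OF that] by (elim exE conjE) simp
    next
      fix U x assume "openin X U \<and> x \<in> U"
      then show "\<exists>V. (\<exists>F. finite F \<and> F \<subseteq> B \<and> V = topspace X \<inter> \<Inter>F) \<and> x \<in> V \<and> V \<subseteq> U"
        using nbh by (elim conjE)
    qed
  qed
  then show ?thesis unfolding subbasis_of_def by blast
qed

lemma subbasis_of_openin: "subbasis_of X B \<Longrightarrow> U \<in> B \<Longrightarrow> openin X U"
  unfolding subbasis_of_def by blast

lemma subbasis_of_t1_separates:
  assumes "t1_space X" "subbasis_of X B" "x \<in> topspace X" "y \<in> topspace X" "x \<noteq> y"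
  obtains U where "U \<in> B" "x \<in> U" "y \<notin> U"
proof -
  obtain V where V: "openin X V" "x \<in> V" "y \<notin> V"
    using assms(1,3-5) unfolding t1_space_def by blast
  then obtain F where F: "F \<subseteq> B" "x \<in> \<Inter>F" "topspace X \<inter> \<Inter>F \<subseteq> V"
    using assms(2) unfolding subbasis_of_alt by meson
  then have "y \<notin> \<Inter>F" using V(3) assms(4) by blast
  then show ?thesis using F that by blast
qed

text \<open>Alexander's subbase theorem, relative to a subset. The whole space is added to the subbasis
  because the subbasis itself need not cover the space; a cover containing the whole space is
  harmless.\<close>

lemma compactin_subbasis:
  assumes sub: "subbasis_of X B" and K: "K \<subseteq> topspace X"
    and fin: "\<And>C. C \<subseteq> B \<Longrightarrow> K \<subseteq> \<Union>C \<Longrightarrow> \<exists>C'. finite C' \<and> C' \<subseteq> C \<and> K \<subseteq> \<Union>C'"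
  shows "compactin X K"
proof -
  let ?B = "insert (topspace X) B"
  have base: "(finite intersection_of (\<lambda>U. U \<in> ?B) relative_to K) V \<longleftrightarrow>
      (\<exists>F. finite F \<and> F \<subseteq> ?B \<and> V = K \<inter> \<Inter>F)" for V
    by (auto simp: relative_to_def intersection_of_def)
  have opn: "openin (subtopology X K) (K \<inter> \<Inter>F)" if "finite F" "F \<subseteq> ?B" for F
    using that
  proof (induction F rule: finite_induct)
    case empty
    then show ?case using K openin_subtopology_refl by auto
  next
    case (insert U F)
    then have "openin X U" "openin (subtopology X K) (K \<inter> \<Inter>F)"
      using subbasis_of_openin[OF sub] by auto
    then have "openin (subtopology X K) ((K \<inter> U) \<inter> (K \<inter> \<Inter>F))"
      using openin_subtopology_Int2 openin_Int by blast
    then show ?case by (simp add: Int_ac)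
  qed
  have nbh: "\<exists>V. (\<exists>F. finite F \<and> F \<subseteq> ?B \<and> V = K \<inter> \<Inter>F) \<and> x \<in> V \<and> V \<subseteq> U"
    if U: "openin (subtopology X K) U" "x \<in> U" for U x
  proof -
    obtain T where T: "openin X T" "U = T \<inter> K"
      using U unfolding openin_subtopology by blast
    then obtain F where F: "finite F" "F \<subseteq> B" "x \<in> \<Inter>F" "topspace X \<inter> \<Inter>F \<subseteq> T"
      using sub U(2) unfolding subbasis_of_alt by (metis IntD1)
    then have "x \<in> K \<inter> \<Inter>F" "K \<inter> \<Inter>F \<subseteq> U" using T U(2) K by auto
    then show ?thesis using F by blast
  qed
  have "openin (subtopology X K) =
      arbitrary union_of (finite intersection_of (\<lambda>U. U \<in> ?B) relative_to K)"
    unfolding openin_topology_base_unique base using opn nbh by blast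
  then have top: "topology (arbitrary union_of (finite intersection_of (\<lambda>U. U \<in> ?B) relative_to K))
      = subtopology X K"
    by (metis openin_inverse)
  have "compact_space (subtopology X K)"
  proof (rule Alexander_subbase_alt[OF _ _ top])
    show "K \<subseteq> \<Union>?B" using K by auto
    fix C assume C: "C \<subseteq> ?B" "K \<subseteq> \<Union>C"
    show "\<exists>C'. finite C' \<and> C' \<subseteq> C \<and> K \<subseteq> \<Union>C'"
    proof (cases "topspace X \<in> C")
      case True
      then have "finite {topspace X} \<and> {topspace X} \<subseteq> C \<and> K \<subseteq> \<Union>{topspace X}" using K by simp
      then show ?thesis by blast
    next
      case False
      then have "C \<subseteq> B" using C by blast
      then show ?thesis using fin C by blast
    qed
  qed
  then show ?thesis using K by (simp add: compactin_subspace)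
qed

text \<open>The finite intersections themselves do not do as a basis, since the empty intersection, the
  whole space, need not be relatively compact; instead all relatively compact open sets are taken.
  Inside a subbasic set they form a local basis. A point outside all subbasic sets has the whole space
  as its only neighbourhood, so in a \<open>T\<^sub>1\<close> space it is the only point.\<close>

lemma loc_rel_compact_space_subbasis:
  assumes t1: "t1_space X" and sub: "subbasis_of X B"
    and rc: "\<And>U. U \<in> B \<Longrightarrow> relatively_compactin X U"
  shows "loc_rel_compact_space X"
proof -
  have "\<exists>V. (openin X V \<and> relatively_compactin X V) \<and> x \<in> V \<and> V \<subseteq> W"
    if W: "openin X W" "x \<in> W" for W x
  proof (cases "\<exists>U\<in>B. x \<in> U")
    case True
    then obtain U where U: "U \<in> B" "x \<in> U" by blast
    have "X closure_of (W \<inter> U) \<subseteq> X closure_of U" by (simp add: closure_of_mono)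
    then have "relatively_compactin X (W \<inter> U)"
      using rc[OF U(1)] closed_compactin closedin_closure_of
      unfolding relatively_compactin_def by blast
    moreover have "openin X (W \<inter> U)"
      by (rule openin_Int[OF W(1) subbasis_of_openin[OF sub U(1)]])
    ultimately show ?thesis using U W by blast
  next
    case False
    have x: "x \<in> topspace X" using W openin_subset by blast
    have "y = x" if "y \<in> topspace X" for y
    proof (rule ccontr)
      assume "y \<noteq> x"
      with subbasis_of_t1_separates[OF t1 sub x that] False show False by metis
    qed
    then have single: "topspace X = {x}" using x by blast
    then have "W = {x}" using W openin_subset by blast
    moreover have "X closure_of {x} = {x}"
      using single closure_of_subset[of "{x}" X] closure_of_subset_topspace[of X "{x}"] by auto
    ultimately have "relatively_compactin X W"
      using single by (simp add: relatively_compactin_def)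
    then show ?thesis using W by blast
  qed
  then have "basis_of X {V. openin X V \<and> relatively_compactin X V}"
    unfolding basis_of_def openin_topology_base_unique by auto
  then show ?thesis unfolding loc_rel_compact_space_def by blast
qed


section \<open>Covers by an indexed subbasis of a space with closed points\<close>

locale t1_subbasis =
  fixes X :: "'b topology" and s :: "'a \<Rightarrow> 'b set"
    and P :: "'a set" and le :: "'a \<Rightarrow> 'a \<Rightarrow> bool" and \<Theta> :: "'a set set"
  assumes t1: "t1_space X"
    and subbasis: "subbasis_of X (s ` P)"
    and le_iff: "p \<in> P \<Longrightarrow> q \<in> P \<Longrightarrow> le p q \<longleftrightarrow> s p \<subseteq> s q"
    and covers: "\<Theta> = {C. C \<subseteq> P \<and> topspace X \<subseteq> \<Union>(s ` C)}"
begin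

definition avoiding :: "'b \<Rightarrow> 'a set" where
  "avoiding x = {p \<in> P. x \<notin> s p}"

lemma s_subset: "p \<in> P \<Longrightarrow> s p \<subseteq> topspace X"
  by (rule openin_subset[OF subbasis_of_openin[OF subbasis imageI]])

lemma avoiding_not_cover: "x \<in> topspace X \<Longrightarrow> avoiding x \<notin> \<Theta>"
  unfolding covers avoiding_def by blast

text \<open>Points being closed, every point other than \<open>x\<close> lies in a subbasic set that misses \<open>x\<close>. So
  \<open>avoiding x\<close> is a maximal non-cover; these families are the witnesses in all that follows.\<close>

lemma insert_avoiding_cover:
  assumes "x \<in> topspace X" "p \<in> P" "x \<in> s p"
  shows "insert p (avoiding x) \<in> \<Theta>"
proof -
  have "y \<in> \<Union>(s ` insert p (avoiding x))" if y: "y \<in> topspace X" for y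
  proof (cases "y = x")
    case True
    then show ?thesis using assms by blast
  next
    case False
    with subbasis_of_t1_separates[OF t1 subbasis y assms(1)] obtain U
      where "U \<in> s ` P" "y \<in> U" "x \<notin> U" by blast
    then show ?thesis unfolding avoiding_def by blast
  qed
  then show ?thesis using assms unfolding covers avoiding_def by blast
qed

lemma ref_closure_eq: "ref_closure P le \<Theta> = \<Theta>"
proof
  show "ref_closure P le \<Theta> \<subseteq> \<Theta>"
  proof
    fix D assume "D \<in> ref_closure P le \<Theta>"
    then obtain C where D: "D \<subseteq> P" and C: "C \<in> \<Theta>" "refines le C D"
      unfolding ref_closure_def by blast
    have "s c \<subseteq> \<Union>(s ` D)" if c: "c \<in> C" for c
    proof -
      obtain d where "d \<in> D" "le c d" using C(2) c unfolding refines_def by blast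
      moreover from this have "s c \<subseteq> s d"
        using le_iff[of c d] C(1) D c unfolding covers by blast
      ultimately show ?thesis by blast
    qed
    then show "D \<in> \<Theta>" using C D unfolding covers by blast
  qed
  show "\<Theta> \<subseteq> ref_closure P le \<Theta>"
  proof
    fix C assume C: "C \<in> \<Theta>"
    then have "C \<subseteq> P" unfolding covers by blast
    then have "refines le C C" using le_iff unfolding refines_def by blast
    then show "C \<in> ref_closure P le \<Theta>" using C \<open>C \<subseteq> P\<close> unfolding ref_closure_def by blast
  qed
qed

lemma near_subset_iff:
  assumes "S \<subseteq> P"
  shows "near_subset P le \<Theta> S \<longleftrightarrow> (\<exists>x\<in>topspace X. \<forall>p\<in>S. x \<in> s p)"
proof
  assume "near_subset P le \<Theta> S"
  then obtain D where D: "D \<subseteq> P" "D \<notin> \<Theta>" "\<forall>p\<in>S. D \<union> {p} \<in> \<Theta>"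
    unfolding near_subset_def ref_closure_eq by blast
  then obtain x where "x \<in> topspace X" "x \<notin> \<Union>(s ` D)" unfolding covers by blast
  moreover from this have "\<forall>p\<in>S. x \<in> s p" using D(3) unfolding covers by blast
  ultimately show "\<exists>x\<in>topspace X. \<forall>p\<in>S. x \<in> s p" by blast
next
  assume "\<exists>x\<in>topspace X. \<forall>p\<in>S. x \<in> s p"
  then obtain x where x: "x \<in> topspace X" "\<forall>p\<in>S. x \<in> s p" by blast
  have "avoiding x \<subseteq> P" unfolding avoiding_def by blast
  moreover have "\<forall>p\<in>S. avoiding x \<union> {p} \<in> \<Theta>"
    using insert_avoiding_cover x assms by auto
  ultimately show "near_subset P le \<Theta> S"
    unfolding near_subset_def ref_closure_eq using avoiding_not_cover x by blast
qed

text \<open>If \<open>x\<close> is in the closure, every finite set of indices of neighbourhoods of \<open>x\<close> is near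
  together with \<open>S\<close>, so \<open>avoiding x\<close> is a Cauchy family, and adding \<open>C\<close> to it gives a cover only if \<open>C\<close> covers \<open>x\<close>. A
  point outside the closure has a basic neighbourhood whose finitely many indices are far together
  with \<open>S\<close>; a Cauchy family contains one of them.\<close>

lemma restriction_eq:
  assumes S: "S \<subseteq> P"
  shows "restriction P le \<Theta> S =
    {C. C \<subseteq> P \<and> X closure_of {x \<in> topspace X. \<forall>p\<in>S. x \<in> s p} \<subseteq> \<Union>(s ` C)}"
proof -
  let ?T = "{x \<in> topspace X. \<forall>p\<in>S. x \<in> s p}"
  have far: "F \<in> far_finite P le \<Theta> S \<longleftrightarrow> finite F \<and> F \<subseteq> P \<and> ?T \<inter> \<Inter>(s ` F) = {}" for F
  proof (cases "F \<subseteq> P")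
    case True
    have "(\<exists>x\<in>topspace X. \<forall>p\<in>F \<union> S. x \<in> s p) \<longleftrightarrow> ?T \<inter> \<Inter>(s ` F) \<noteq> {}" by blast
    then show ?thesis
      unfolding far_finite_def using near_subset_iff[of "F \<union> S"] S True by auto
  next
    case False
    then show ?thesis unfolding far_finite_def by blast
  qed
  have "X closure_of ?T \<subseteq> \<Union>(s ` C)" if C: "C \<in> restriction P le \<Theta> S" for C
  proof
    fix x assume x: "x \<in> X closure_of ?T"
    then have xX: "x \<in> topspace X" by (simp add: in_closure_of)
    have "cauchy_for (far_finite P le \<Theta> S) (avoiding x)"
      unfolding cauchy_for_def
    proof
      fix F assume "F \<in> far_finite P le \<Theta> S"
      then have F: "finite F" "F \<subseteq> P" "?T \<inter> \<Inter>(s ` F) = {}" unfolding far by auto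
      show "F \<inter> avoiding x \<noteq> {}"
      proof
        assume "F \<inter> avoiding x = {}"
        then have xF: "x \<in> topspace X \<inter> \<Inter>(s ` F)"
          using F(2) xX unfolding avoiding_def by blast
        have "openin X (topspace X \<inter> \<Inter>(s ` F))"
        proof (cases "F = {}")
          case False
          then have "openin X (\<Inter>(s ` F))"
            using F(1,2) subbasis_of_openin[OF subbasis] by (intro openin_Inter) auto
          then show ?thesis by blast
        qed simp
        with x xF have "\<exists>y\<in>?T. y \<in> topspace X \<inter> \<Inter>(s ` F)"
          unfolding in_closure_of by blast
        then show False using F(3) by blast
      qed
    qed
    moreover have "avoiding x \<subseteq> P" unfolding avoiding_def by blast
    ultimately have "C \<union> avoiding x \<in> \<Theta>"
      using C unfolding restriction_def ref_closure_eq by blast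
    then show "x \<in> \<Union>(s ` C)" using xX unfolding covers avoiding_def by blast
  qed
  moreover have "C \<in> restriction P le \<Theta> S"
    if C: "C \<subseteq> P" "X closure_of ?T \<subseteq> \<Union>(s ` C)" for C
  proof -
    have "C \<union> D \<in> \<Theta>" if D: "D \<subseteq> P" "cauchy_for (far_finite P le \<Theta> S) D" for D
    proof -
      have "y \<in> \<Union>(s ` (C \<union> D))" if y: "y \<in> topspace X" for y
      proof (cases "y \<in> X closure_of ?T")
        case True
        then show ?thesis using C(2) by blast
      next
        case False
        then obtain U where U: "openin X U" "y \<in> U" "U \<inter> ?T = {}"
          using y unfolding in_closure_of by blast
        then obtain G where G: "finite G" "G \<subseteq> s ` P" "y \<in> \<Inter>G" "topspace X \<inter> \<Inter>G \<subseteq> U"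
          using subbasis unfolding subbasis_of_alt by meson
        then obtain F where F: "finite F" "F \<subseteq> P" "G = s ` F"
          by (meson finite_subset_image)
        have "?T \<inter> \<Inter>(s ` F) = {}" using G(4) U(3) F(3) by blast
        then have "F \<in> far_finite P le \<Theta> S" using F far by simp
        then have "F \<inter> D \<noteq> {}" using D(2) unfolding cauchy_for_def by blast
        then show ?thesis using G(3) F(3) by blast
      qed
      then show ?thesis using C D unfolding covers by blast
    qed
    then show ?thesis using C unfolding restriction_def ref_closure_eq by blast
  qed
  ultimately show ?thesis unfolding restriction_def by blast
qed

lemma restriction_singleton:
  assumes "p \<in> P"
  shows "restriction P le \<Theta> {p} = {C. C \<subseteq> P \<and> X closure_of s p \<subseteq> \<Union>(s ` C)}"
proof -
  have "{x \<in> topspace X. \<forall>q\<in>{p}. x \<in> s q} = s p" using s_subset[OF assms] by auto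
  then show ?thesis using restriction_eq[of "{p}"] assms by simp
qed

lemma restriction_empty: "restriction P le \<Theta> {} = \<Theta>"
  using restriction_eq[of "{}"] by (simp add: covers)

text \<open>If \<open>x \<in> s p - s q\<close>, the family \<open>avoiding x\<close> becomes a cover by adding \<open>p\<close>, but not by
  adding \<open>q\<close>.\<close>

lemma theta_le_iff:
  assumes "p \<in> P" "q \<in> P"
  shows "theta_le P \<Theta> p q \<longleftrightarrow> le p q"
proof
  assume L: "theta_le P \<Theta> p q"
  have "x \<in> s q" if x: "x \<in> s p" for x
  proof -
    have xX: "x \<in> topspace X" using s_subset assms x by blast
    moreover have "avoiding x \<subseteq> P" unfolding avoiding_def by blast
    ultimately have "avoiding x \<union> {q} \<in> \<Theta>"
      using L insert_avoiding_cover[OF _ assms(1) x] unfolding theta_le_def by auto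
    then show ?thesis using xX unfolding covers avoiding_def by blast
  qed
  then show "le p q" using le_iff assms by blast
next
  assume "le p q"
  then have "s p \<subseteq> s q" using le_iff assms by blast
  then show "theta_le P \<Theta> p q" unfolding theta_le_def covers using assms by fastforce
qed

lemma generalised_wallman_posetI:
  assumes inj: "inj_on s P" and rc: "\<And>p. p \<in> P \<Longrightarrow> relatively_compactin X (s p)"
  shows "generalised_wallman_poset P le \<Theta>"
  unfolding generalised_wallman_poset_def
proof (intro conjI ballI)
  show "poset_on P le"
    unfolding poset_on_def
  proof (intro conjI)
    show "reflp_on P le" using le_iff by (auto simp: reflp_on_def)
    show "antisymp_on P le"
      using le_iff inj by (auto simp: antisymp_on_def inj_on_def)
    show "transp_on P le" using le_iff by (fastforce simp: transp_on_def)
  qed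
  show "\<Theta> \<subseteq> Pow P" unfolding covers by blast
  show "\<Theta> = restriction P le \<Theta> {}" by (simp add: restriction_empty)
  show "le p q \<longleftrightarrow> theta_le P \<Theta> p q" if "p \<in> P" "q \<in> P" for p q
    using theta_le_iff that by simp
next
  fix p C assume p: "p \<in> P" and "C \<in> restriction P le \<Theta> {p}"
  then have C: "C \<subseteq> P" "X closure_of s p \<subseteq> \<Union>(s ` C)"
    unfolding restriction_singleton[OF p] by auto
  have "\<forall>U\<in>s ` C. openin X U" using C(1) subbasis_of_openin[OF subbasis] by blast
  then obtain G where G: "finite G" "G \<subseteq> s ` C" "X closure_of s p \<subseteq> \<Union>G"
    using rc[OF p] C(2) unfolding relatively_compactin_def compactin_def by meson
  then obtain F where F: "finite F" "F \<subseteq> C" "G = s ` F" by (meson finite_subset_image)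
  have "refines le F C" unfolding refines_def using F(2) C(1) le_iff by blast
  moreover have "F \<in> restriction P le \<Theta> {p}"
    unfolding restriction_singleton[OF p] using F C(1) G(3) by blast
  ultimately show "\<exists>F \<in> restriction P le \<Theta> {p}. finite F \<and> refines le F C" using F(1) by blast
qed

text \<open>This recovers compactness from finite refinements: by Alexander's theorem only covers by subbasic sets matter, and these
  are the members of \<open>\<Theta>|p\<close>.\<close>

lemma relatively_compactinI:
  assumes p: "p \<in> P"
    and fin: "\<And>C. C \<in> restriction P le \<Theta> {p} \<Longrightarrow>
      \<exists>F \<in> restriction P le \<Theta> {p}. finite F \<and> refines le F C"
  shows "relatively_compactin X (s p)"
proof -
  have "compactin X (X closure_of s p)"
  proof (rule compactin_subbasis[OF subbasis])
    show "X closure_of s p \<subseteq> topspace X" by (rule closure_of_subset_topspace)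
    fix B assume "B \<subseteq> s ` P" "X closure_of s p \<subseteq> \<Union>B"
    then obtain C where C: "C \<subseteq> P" "B = s ` C" by (meson subset_imageE)
    then have "C \<in> restriction P le \<Theta> {p}"
      using \<open>X closure_of s p \<subseteq> \<Union>B\<close> unfolding restriction_singleton[OF p] by blast
    from fin[OF this] obtain F where F: "F \<subseteq> P" "X closure_of s p \<subseteq> \<Union>(s ` F)"
      "finite F" "refines le F C"
      unfolding restriction_singleton[OF p] by blast
    then obtain r where r: "\<forall>f\<in>F. r f \<in> C \<and> le f (r f)" unfolding refines_def by metis
    have "s f \<subseteq> s (r f)" if "f \<in> F" for f
      using le_iff[of f "r f"] r F(1) C(1) that by auto
    then have "\<Union>(s ` F) \<subseteq> \<Union>(s ` r ` F)" by (simp add: UN_mono)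
    then have "X closure_of s p \<subseteq> \<Union>(s ` r ` F)" using F(2) by (rule order_trans[rotated])
    moreover have "s ` r ` F \<subseteq> B" using r C(2) by auto
    ultimately show "\<exists>C'. finite C' \<and> C' \<subseteq> B \<and> X closure_of s p \<subseteq> \<Union>C'"
      using F(3) by (intro exI[of _ "s ` r ` F"]) simp
  qed
  then show ?thesis using s_subset[OF p] unfolding relatively_compactin_def by blast
qed

definition neighbourhoods :: "'b \<Rightarrow> 'a set" where
  "neighbourhoods x = {p \<in> P. x \<in> s p}"

lemma neighbourhoods_in_spectrum:
  assumes x: "x \<in> topspace X"
  shows "neighbourhoods x \<in> spectrum_points P le \<Theta>"
proof -
  have "up_set_in P le (neighbourhoods x)"
    unfolding up_set_in_def neighbourhoods_def using le_iff by blast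
  moreover have "cauchy_for \<Theta> (neighbourhoods x)"
    unfolding cauchy_for_def neighbourhoods_def covers using x by blast
  moreover have "round_for le \<Theta> (neighbourhoods x)"
    unfolding round_for_def
  proof
    fix r assume "r \<in> neighbourhoods x"
    then have r: "r \<in> P" "x \<in> s r" unfolding neighbourhoods_def by auto
    have "\<forall>c \<in> insert r (avoiding x) \<inter> neighbourhoods x. le c r"
      using r le_iff unfolding avoiding_def neighbourhoods_def by blast
    then show "\<exists>C\<in>\<Theta>. \<forall>c\<in>C \<inter> neighbourhoods x. le c r"
      using insert_avoiding_cover[OF x r] by blast
  qed
  ultimately show ?thesis unfolding spectrum_points_def by blast
qed

text \<open>The complement of a Cauchy set \<open>R\<close> is not a cover, so some point \<open>x\<close> has all its subbasic
  neighbourhoods in \<open>R\<close>; roundness then puts \<open>x\<close> into every member of \<open>R\<close>.\<close>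

lemma spectrum_point_is_neighbourhoods:
  assumes R: "R \<in> spectrum_points P le \<Theta>"
  shows "\<exists>x\<in>topspace X. R = neighbourhoods x"
proof -
  have RP: "R \<subseteq> P" and cau: "cauchy_for \<Theta> R" and rnd: "round_for le \<Theta> R"
    using R unfolding spectrum_points_def up_set_in_def by auto
  have "P - R \<notin> \<Theta>" using cau unfolding cauchy_for_def by blast
  then obtain x where x: "x \<in> topspace X" "x \<notin> \<Union>(s ` (P - R))" unfolding covers by blast
  then have sub: "neighbourhoods x \<subseteq> R" unfolding neighbourhoods_def by blast
  have "r \<in> neighbourhoods x" if r: "r \<in> R" for r
  proof -
    obtain C where C: "C \<in> \<Theta>" "\<forall>c\<in>C \<inter> R. le c r"
      using rnd r unfolding round_for_def by blast
    then obtain c where c: "c \<in> C" "c \<in> P" "x \<in> s c" using x(1) unfolding covers by blast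
    then have "le c r" using C(2) sub unfolding neighbourhoods_def by blast
    then show ?thesis using c r RP le_iff unfolding neighbourhoods_def by blast
  qed
  then show ?thesis using sub x(1) by blast
qed

lemma neighbourhoods_inj: "inj_on neighbourhoods (topspace X)"
proof (rule inj_onI, rule ccontr)
  fix x y assume xy: "x \<in> topspace X" "y \<in> topspace X" "neighbourhoods x = neighbourhoods y" "x \<noteq> y"
  obtain U where "U \<in> s ` P" "x \<in> U" "y \<notin> U"
    using subbasis_of_t1_separates[OF t1 subbasis xy(1,2,4)] by blast
  then show False using xy(3) unfolding neighbourhoods_def by blast
qed

lemma spectrum_homeomorphic: "spectrum P le \<Theta> homeomorphic_space X"
proof -
  let ?Y = "spectrum P le \<Theta>"
  have onto: "neighbourhoods ` topspace X = topspace ?Y"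
    unfolding topspace_spectrum
    using neighbourhoods_in_spectrum spectrum_point_is_neighbourhoods by blast
  have preim: "{x \<in> topspace X. neighbourhoods x \<in> spectrum_sub P le \<Theta> p} = s p" if "p \<in> P" for p
    using that s_subset[OF that] neighbourhoods_in_spectrum
    unfolding spectrum_sub_def by (auto simp: neighbourhoods_def)
  have "continuous_map X ?Y neighbourhoods"
    unfolding spectrum_def
  proof (rule continuous_map_into_topology_subbase)
    show "neighbourhoods x \<in> topspace (topology (arbitrary union_of
        (finite intersection_of (\<lambda>U. U \<in> spectrum_sub P le \<Theta> ` P)
          relative_to spectrum_points P le \<Theta>)))"
      if "x \<in> topspace X" for x
      using neighbourhoods_in_spectrum[OF that] by simp
    show "openin X {x \<in> topspace X. neighbourhoods x \<in> U}"
      if "U \<in> spectrum_sub P le \<Theta> ` P" for U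
      using that preim subbasis_of_openin[OF subbasis] by auto
  qed
  moreover have "open_map X ?Y neighbourhoods"
    unfolding open_map_def
  proof (intro allI impI)
    fix U assume U: "openin X U"
    have "\<exists>V. (finite intersection_of (\<lambda>U. U \<in> spectrum_sub P le \<Theta> ` P)
           relative_to spectrum_points P le \<Theta>) V \<and> R \<in> V \<and> V \<subseteq> neighbourhoods ` U"
      if R: "R \<in> neighbourhoods ` U" for R
    proof -
      obtain x where x: "x \<in> U" "R = neighbourhoods x" using R by blast
      then have xX: "x \<in> topspace X" using U openin_subset by blast
      obtain G where G: "finite G" "G \<subseteq> s ` P" "x \<in> \<Inter>G" "topspace X \<inter> \<Inter>G \<subseteq> U"
        using U x(1) subbasis unfolding subbasis_of_alt by meson
      then obtain F where F: "finite F" "F \<subseteq> P" "G = s ` F" by (meson finite_subset_image)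
      let ?V = "spectrum_points P le \<Theta> \<inter> \<Inter>(spectrum_sub P le \<Theta> ` F)"
      have "(finite intersection_of (\<lambda>U. U \<in> spectrum_sub P le \<Theta> ` P)
           relative_to spectrum_points P le \<Theta>) ?V"
        unfolding relative_to_def intersection_of_def using F by blast
      moreover have "R \<in> ?V"
        using F G(3) x(2) neighbourhoods_in_spectrum[OF xX]
        unfolding spectrum_sub_def neighbourhoods_def by auto
      moreover have "?V \<subseteq> neighbourhoods ` U"
      proof
        fix R' assume R': "R' \<in> ?V"
        then obtain y where y: "y \<in> topspace X" "R' = neighbourhoods y"
          using spectrum_point_is_neighbourhoods by blast
        then have "y \<in> \<Inter>G" using R' F unfolding spectrum_sub_def neighbourhoods_def by auto
        then show "R' \<in> neighbourhoods ` U" using y G(4) by blast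
      qed
      ultimately show ?thesis by blast
    qed
    then show "openin ?Y (neighbourhoods ` U)"
      unfolding openin_spectrum by (subst arbitrary_union_of_alt) blast
  qed
  ultimately have "homeomorphic_map X ?Y neighbourhoods"
    using onto neighbourhoods_inj by (intro bijective_open_imp_homeomorphic_map)
  then show ?thesis
    using homeomorphic_map_imp_homeomorphic_space homeomorphic_space_sym by blast
qed

end


section \<open>The spectrum of a generalised Wallman poset\<close>

locale generalised_wallman =
  fixes P :: "'a set" and le :: "'a \<Rightarrow> 'a \<Rightarrow> bool" and \<Theta> :: "'a set set"
  assumes gwp: "generalised_wallman_poset P le \<Theta>"
begin

lemma le_refl: "p \<in> P \<Longrightarrow> le p p"
  using gwp unfolding generalised_wallman_poset_def poset_on_def reflp_on_def by blast

lemma le_trans: "p \<in> P \<Longrightarrow> q \<in> P \<Longrightarrow> r \<in> P \<Longrightarrow> le p q \<Longrightarrow> le q r \<Longrightarrow> le p r"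
  using gwp unfolding generalised_wallman_poset_def poset_on_def transp_on_def by blast

lemma cover_subset: "C \<in> \<Theta> \<Longrightarrow> C \<subseteq> P"
  using gwp unfolding generalised_wallman_poset_def by blast

lemma cover_restriction_empty: "\<Theta> = restriction P le \<Theta> {}"
  using gwp unfolding generalised_wallman_poset_def by blast

lemma restriction_finite:
  "p \<in> P \<Longrightarrow> C \<in> restriction P le \<Theta> {p} \<Longrightarrow>
     \<exists>F \<in> restriction P le \<Theta> {p}. finite F \<and> refines le F C"
  using gwp unfolding generalised_wallman_poset_def by blast

lemma le_theta_le: "p \<in> P \<Longrightarrow> q \<in> P \<Longrightarrow> le p q \<longleftrightarrow> theta_le P \<Theta> p q"
  using gwp unfolding generalised_wallman_poset_def by blast

lemma ref_closure_refines:
  assumes "C \<in> ref_closure P le \<Theta>" "refines le C D" "D \<subseteq> P"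
  shows "D \<in> ref_closure P le \<Theta>"
proof -
  obtain B where B: "B \<in> \<Theta>" "refines le B C" "C \<subseteq> P"
    using assms(1) unfolding ref_closure_def by blast
  have "refines le B D"
    unfolding refines_def
  proof
    fix b assume b: "b \<in> B"
    then obtain c where c: "c \<in> C" "le b c" using B(2) unfolding refines_def by blast
    then obtain d where d: "d \<in> D" "le c d" using assms(2) unfolding refines_def by blast
    have "le b d" using le_trans[of b c d] b c d B(1,3) assms(3) cover_subset by blast
    then show "\<exists>d\<in>D. le b d" using d by blast
  qed
  then show ?thesis using B(1) assms(3) unfolding ref_closure_def by blast
qed

lemma restriction_refines:
  assumes C: "C \<in> restriction P le \<Theta> S" "refines le C C'" "C' \<subseteq> P"
  shows "C' \<in> restriction P le \<Theta> S"
proof -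
  have "C' \<union> D \<in> ref_closure P le \<Theta>"
    if D: "D \<subseteq> P" "cauchy_for (far_finite P le \<Theta> S) D" for D
  proof (rule ref_closure_refines)
    show "C \<union> D \<in> ref_closure P le \<Theta>" using C(1) D unfolding restriction_def by blast
    show "refines le (C \<union> D) (C' \<union> D)" using C(2) D(1) le_refl unfolding refines_def by blast
    show "C' \<union> D \<subseteq> P" using C(3) D(1) by blast
  qed
  then show ?thesis using C(3) unfolding restriction_def by blast
qed

lemma restriction_mono:
  assumes "C \<in> restriction P le \<Theta> S" "C \<subseteq> C'" "C' \<subseteq> P"
  shows "C' \<in> restriction P le \<Theta> S"
  using restriction_refines[OF assms(1) _ assms(3)] assms(2,3) le_refl
  unfolding refines_def by blast

lemma cover_refines: "C \<in> \<Theta> \<Longrightarrow> refines le C D \<Longrightarrow> D \<subseteq> P \<Longrightarrow> D \<in> \<Theta>"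
  using restriction_refines[of C "{}" D] cover_restriction_empty by simp

lemma cover_mono: "C \<in> \<Theta> \<Longrightarrow> C \<subseteq> D \<Longrightarrow> D \<subseteq> P \<Longrightarrow> D \<in> \<Theta>"
  using restriction_mono[of C "{}" D] cover_restriction_empty by simp

lemma ref_closure_cover: "ref_closure P le \<Theta> = \<Theta>"
proof
  show "ref_closure P le \<Theta> \<subseteq> \<Theta>"
    unfolding ref_closure_def using cover_refines by blast
  show "\<Theta> \<subseteq> ref_closure P le \<Theta>"
    unfolding ref_closure_def refines_def using cover_subset le_refl by blast
qed

definition maximal_noncover :: "'a set \<Rightarrow> bool" where
  "maximal_noncover M \<longleftrightarrow> M \<subseteq> P \<and> M \<notin> \<Theta> \<and> (\<forall>q\<in>P - M. insert q M \<in> \<Theta>)"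

text \<open>A cover witnessing roundness of \<open>R\<close> at \<open>r\<close> refines \<open>insert r (P - R)\<close>; conversely this family
  itself is a witness. That \<open>R\<close> is an up-set follows since below an element of a maximal
  non-cover there are only elements of it.\<close>

lemma spectrum_points_iff:
  "R \<in> spectrum_points P le \<Theta> \<longleftrightarrow> R \<subseteq> P \<and> maximal_noncover (P - R)"
proof
  assume R: "R \<in> spectrum_points P le \<Theta>"
  then have RP: "R \<subseteq> P" and cau: "cauchy_for \<Theta> R" and rnd: "round_for le \<Theta> R"
    unfolding spectrum_points_def up_set_in_def by auto
  have "insert r (P - R) \<in> \<Theta>" if r: "r \<in> R" for r
  proof -
    obtain C where C: "C \<in> \<Theta>" "\<forall>c\<in>C \<inter> R. le c r"
      using rnd r unfolding round_for_def by blast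
    then have "refines le C (insert r (P - R))"
      using le_refl cover_subset[OF C(1)] unfolding refines_def by blast
    then show ?thesis using cover_refines[OF C(1)] RP r by blast
  qed
  moreover have "P - R \<notin> \<Theta>" using cau unfolding cauchy_for_def by blast
  ultimately show "R \<subseteq> P \<and> maximal_noncover (P - R)"
    using RP unfolding maximal_noncover_def by blast
next
  assume R: "R \<subseteq> P \<and> maximal_noncover (P - R)"
  then have non: "P - R \<notin> \<Theta>" and ins: "\<And>r. r \<in> R \<Longrightarrow> insert r (P - R) \<in> \<Theta>"
    unfolding maximal_noncover_def by auto
  have cau: "cauchy_for \<Theta> R"
    unfolding cauchy_for_def
  proof (intro ballI notI)
    fix C assume C: "C \<in> \<Theta>" "C \<inter> R = {}"
    then have "C \<subseteq> P - R" using cover_subset by blast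
    then show False using C(1) cover_mono non by blast
  qed
  have up: "q \<in> R" if r: "r \<in> R" "q \<in> P" "le r q" for r q
  proof (rule ccontr)
    assume "q \<notin> R"
    then have "refines le (insert r (P - R)) (P - R)"
      using r le_refl unfolding refines_def by blast
    then show False using cover_refines[OF ins[OF r(1)]] non by blast
  qed
  have "round_for le \<Theta> R"
    unfolding round_for_def
  proof
    fix r assume r: "r \<in> R"
    have "\<forall>c\<in>insert r (P - R) \<inter> R. le c r" using r R le_refl by blast
    then show "\<exists>C\<in>\<Theta>. \<forall>c\<in>C \<inter> R. le c r" using ins[OF r] by blast
  qed
  then show "R \<in> spectrum_points P le \<Theta>"
    using R cau up unfolding spectrum_points_def up_set_in_def by blast
qed

text \<open>Chains of non-members of \<open>\<Theta>|p\<close> have upper bounds because each member is refined by a finite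
  one.\<close>

lemma restriction_maximal_nonmember:
  assumes p: "p \<in> P" and C: "C \<subseteq> P" "C \<notin> restriction P le \<Theta> {p}"
  obtains M where "C \<subseteq> M" "M \<subseteq> P" "M \<notin> restriction P le \<Theta> {p}"
    "\<And>N. M \<subseteq> N \<Longrightarrow> N \<subseteq> P \<Longrightarrow> N \<notin> restriction P le \<Theta> {p} \<Longrightarrow> N = M"
proof -
  let ?A = "{M. C \<subseteq> M \<and> M \<subseteq> P \<and> M \<notin> restriction P le \<Theta> {p}}"
  have "\<exists>M\<in>?A. \<forall>N\<in>?A. M \<subseteq> N \<longrightarrow> N = M"
  proof (rule subset_Zorn_nonempty)
    show "?A \<noteq> {}" using C by blast
    fix \<C> assume ne: "\<C> \<noteq> {}" and ch: "subset.chain ?A \<C>"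
    then have sub: "\<C> \<subseteq> ?A" unfolding subset_chain_def by blast
    have "\<Union>\<C> \<notin> restriction P le \<Theta> {p}"
    proof
      assume "\<Union>\<C> \<in> restriction P le \<Theta> {p}"
      then obtain F where F: "F \<in> restriction P le \<Theta> {p}" "finite F" "refines le F (\<Union>\<C>)"
        using restriction_finite[OF p] by blast
      then obtain r where r: "\<forall>f\<in>F. r f \<in> \<Union>\<C> \<and> le f (r f)" unfolding refines_def by metis
      then have "finite (r ` F)" "r ` F \<subseteq> \<Union>\<C>" using F(2) by auto
      then obtain B where B: "B \<in> \<C>" "r ` F \<subseteq> B"
        using finite_subset_Union_chain[OF _ _ ne ch] by blast
      then have "refines le F B" using r unfolding refines_def by blast
      then have "B \<in> restriction P le \<Theta> {p}"
        using restriction_refines[OF F(1)] B(1) sub by blast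
      then show False using B(1) sub by blast
    qed
    then show "\<Union>\<C> \<in> ?A" using sub ne by blast
  qed
  then obtain M where M: "M \<in> ?A" "\<forall>N\<in>?A. M \<subseteq> N \<longrightarrow> N = M" by blast
  show thesis
  proof (rule that)
    show "C \<subseteq> M" "M \<subseteq> P" "M \<notin> restriction P le \<Theta> {p}" using M(1) by auto
    show "N = M" if "M \<subseteq> N" "N \<subseteq> P" "N \<notin> restriction P le \<Theta> {p}" for N
      using M that by blast
  qed
qed

text \<open>Topologically, one looks for a point missed by \<open>C\<close> in the compact closure of the set indexed by
  some \<open>p\<close>, so \<open>p\<close> must be chosen such that \<open>C\<close> is no member of \<open>\<Theta>|p\<close>. Once \<open>C\<close> is enlarged to
  a non-cover \<open>E\<close> meeting all far finite sets, every \<open>p\<close> outside \<open>E\<close> will do. If there is no such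
  \<open>p\<close>, then \<open>E = P\<close>; this happens only if there are no covers at all.\<close>

lemma noncover_extends:
  assumes C: "C \<subseteq> P" "C \<notin> \<Theta>"
  obtains M where "C \<subseteq> M" "maximal_noncover M"
proof -
  have "C \<notin> restriction P le \<Theta> {}" using C(2) cover_restriction_empty by blast
  then obtain D where D: "D \<subseteq> P" "cauchy_for (far_finite P le \<Theta> {}) D" "C \<union> D \<notin> \<Theta>"
    using C(1) unfolding restriction_def ref_closure_cover by blast
  define E where "E = C \<union> D"
  have E: "E \<subseteq> P" "E \<notin> \<Theta>" "cauchy_for (far_finite P le \<Theta> {}) E"
    using C D unfolding E_def cauchy_for_def by auto
  show thesis
  proof (cases "E = P")
    case True
    then have "maximal_noncover P" using E unfolding maximal_noncover_def by blast
    then show thesis using that C(1) by blast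
  next
    case False
    then obtain p where p: "p \<in> P" "p \<notin> E" using E(1) by blast
    \<comment> \<open>A finite set far from \<open>p\<close> becomes far when \<open>p\<close> is added; as \<open>p \<notin> E\<close>, the element in which
      \<open>E\<close> meets the enlarged set lies in the original one.\<close>
    have "F \<inter> E \<noteq> {}" if "F \<in> far_finite P le \<Theta> {p}" for F
    proof -
      have "F \<union> {p} \<in> far_finite P le \<Theta> {}" using that p(1) unfolding far_finite_def by auto
      then have "(F \<union> {p}) \<inter> E \<noteq> {}" using E(3) unfolding cauchy_for_def by blast
      then show ?thesis using p(2) by blast
    qed
    then have "cauchy_for (far_finite P le \<Theta> {p}) E" unfolding cauchy_for_def by blast
    then have "E \<notin> restriction P le \<Theta> {p}"
      using E(1,2) unfolding restriction_def ref_closure_cover by auto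
    then obtain M where M: "E \<subseteq> M" "M \<subseteq> P" "M \<notin> restriction P le \<Theta> {p}"
      and maxM: "\<And>N. M \<subseteq> N \<Longrightarrow> N \<subseteq> P \<Longrightarrow> N \<notin> restriction P le \<Theta> {p} \<Longrightarrow> N = M"
      using restriction_maximal_nonmember[OF p(1) E(1)] by metis
    obtain G where G: "G \<subseteq> P" "cauchy_for (far_finite P le \<Theta> {p}) G" "M \<union> G \<notin> \<Theta>"
      using M(2,3) unfolding restriction_def ref_closure_cover by blast
    \<comment> \<open>The Cauchy family that excludes \<open>M\<close> from \<open>\<Theta>|p\<close> is absorbed by \<open>M\<close>, hence \<open>M\<close> itself is
      Cauchy. A Cauchy family that is not a cover is not in \<open>\<Theta>|p\<close> either, so maximality of \<open>M\<close>
      carries over to the non-covers.\<close>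
    have nonmember: "N \<notin> restriction P le \<Theta> {p}"
      if "N \<subseteq> P" "N \<notin> \<Theta>" "cauchy_for (far_finite P le \<Theta> {p}) N" for N
      using that unfolding restriction_def ref_closure_cover by auto
    have cau: "cauchy_for (far_finite P le \<Theta> {p}) (M \<union> G)"
      using G(2) unfolding cauchy_for_def by blast
    have "M \<union> G \<notin> restriction P le \<Theta> {p}" using nonmember[of "M \<union> G"] cau G M(2) by blast
    then have MG: "M \<union> G = M" using maxM[of "M \<union> G"] M(2) G(1) by blast
    have "insert q M \<in> \<Theta>" if q: "q \<in> P - M" for q
    proof (rule ccontr)
      assume "insert q M \<notin> \<Theta>"
      moreover have "cauchy_for (far_finite P le \<Theta> {p}) (insert q M)"
        using cau MG unfolding cauchy_for_def by blast
      ultimately have "insert q M \<notin> restriction P le \<Theta> {p}"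
        using nonmember[of "insert q M"] M(2) q by blast
      then show False using maxM[of "insert q M"] M(2) q by blast
    qed
    then have "maximal_noncover M" using M(2) G(3) MG unfolding maximal_noncover_def by auto
    moreover have "C \<subseteq> M" using M(1) unfolding E_def by blast
    ultimately show thesis using that by blast
  qed
qed

lemma noncover_spectrum_point:
  assumes "C \<subseteq> P" "C \<notin> \<Theta>"
  obtains R where "R \<in> spectrum_points P le \<Theta>" "C \<inter> R = {}"
proof -
  obtain M where M: "C \<subseteq> M" "maximal_noncover M" using noncover_extends assms by blast
  then have "P - (P - M) = M" unfolding maximal_noncover_def by blast
  then have "P - M \<in> spectrum_points P le \<Theta>" using M(2) spectrum_points_iff[of "P - M"] by auto
  then show ?thesis using that M(1) by blast
qed

lemma cover_iff:
  assumes C: "C \<subseteq> P"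
  shows "C \<in> \<Theta> \<longleftrightarrow> topspace (spectrum P le \<Theta>) = (\<Union>c\<in>C. spectrum_sub P le \<Theta> c)"
proof
  assume "C \<in> \<Theta>"
  then have "\<exists>c\<in>C. c \<in> R" if "R \<in> spectrum_points P le \<Theta>" for R
    using that unfolding spectrum_points_def cauchy_for_def by blast
  then show "topspace (spectrum P le \<Theta>) = (\<Union>c\<in>C. spectrum_sub P le \<Theta> c)"
    unfolding topspace_spectrum spectrum_sub_def by blast
next
  assume eq: "topspace (spectrum P le \<Theta>) = (\<Union>c\<in>C. spectrum_sub P le \<Theta> c)"
  show "C \<in> \<Theta>"
  proof (rule ccontr)
    assume "C \<notin> \<Theta>"
    then obtain R where "R \<in> spectrum_points P le \<Theta>" "C \<inter> R = {}"
      using noncover_spectrum_point C by blast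
    then show False using eq unfolding topspace_spectrum spectrum_sub_def by blast
  qed
qed

text \<open>If \<open>p \<le> q\<close> fails, some non-cover \<open>S \<union> {q}\<close> becomes a cover upon replacing \<open>q\<close> by \<open>p\<close>; a
  point missing the former contains \<open>p\<close> but not \<open>q\<close>.\<close>

lemma le_iff_spectrum_sub:
  assumes "p \<in> P" "q \<in> P"
  shows "le p q \<longleftrightarrow> spectrum_sub P le \<Theta> p \<subseteq> spectrum_sub P le \<Theta> q"
proof
  assume "le p q"
  then show "spectrum_sub P le \<Theta> p \<subseteq> spectrum_sub P le \<Theta> q"
    using assms(2) unfolding spectrum_sub_def spectrum_points_def up_set_in_def by blast
next
  assume sub: "spectrum_sub P le \<Theta> p \<subseteq> spectrum_sub P le \<Theta> q"
  show "le p q"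
  proof (rule ccontr)
    assume "\<not> le p q"
    then obtain S where S: "S \<subseteq> P" "S \<union> {p} \<in> \<Theta>" "S \<union> {q} \<notin> \<Theta>"
      using le_theta_le assms unfolding theta_le_def by blast
    then obtain R where R: "R \<in> spectrum_points P le \<Theta>" "(S \<union> {q}) \<inter> R = {}"
      using noncover_spectrum_point[of "S \<union> {q}"] assms(2) by blast
    have "(S \<union> {p}) \<inter> R \<noteq> {}"
      using R(1) S(2) unfolding spectrum_points_def cauchy_for_def by blast
    then show False using R sub unfolding spectrum_sub_def by blast
  qed
qed

lemma spectrum_subbasis: "subbasis_of (spectrum P le \<Theta>) (spectrum_sub P le \<Theta> ` P)"
proof -
  have "openin (spectrum P le \<Theta>) (spectrum_sub P le \<Theta> p)" if "p \<in> P" for p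
  proof -
    have "spectrum_sub P le \<Theta> p =
        spectrum_points P le \<Theta> \<inter> \<Inter>{spectrum_sub P le \<Theta> p}"
      unfolding spectrum_sub_def by auto
    then have "(finite intersection_of (\<lambda>U. U \<in> spectrum_sub P le \<Theta> ` P)
        relative_to spectrum_points P le \<Theta>) (spectrum_sub P le \<Theta> p)"
      unfolding relative_to_def intersection_of_def using that
      by (intro exI[of _ "spectrum_sub P le \<Theta> p"] conjI exI[of _ "{spectrum_sub P le \<Theta> p}"]) auto
    then show ?thesis unfolding openin_spectrum by (rule arbitrary_union_of_inc)
  qed
  then show ?thesis
    unfolding subbasis_of_def basis_of_def topspace_spectrum by (auto simp: openin_spectrum)
qed

text \<open>Complements of distinct maximal non-covers are incomparable.\<close>

lemma spectrum_t1: "t1_space (spectrum P le \<Theta>)"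
  unfolding t1_space_def topspace_spectrum
proof (intro ballI impI)
  fix R R' assume RR: "R \<in> spectrum_points P le \<Theta>" "R' \<in> spectrum_points P le \<Theta>" "R \<noteq> R'"
  have "\<not> R \<subseteq> R'"
  proof
    assume "R \<subseteq> R'"
    then obtain r where r: "r \<in> R'" "r \<notin> R" using RR(3) by blast
    have R: "R \<subseteq> P" "maximal_noncover (P - R)" and R': "R' \<subseteq> P" "maximal_noncover (P - R')"
      using RR spectrum_points_iff by auto
    have "insert r (P - R') \<in> \<Theta>" using R' r unfolding maximal_noncover_def by blast
    then have "P - R \<in> \<Theta>" using cover_mono[of _ "P - R"] r \<open>R \<subseteq> R'\<close> R'(1) by blast
    then show False using R(2) unfolding maximal_noncover_def by blast
  qed
  then obtain p where p: "p \<in> R" "p \<notin> R'" by blast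
  then have "p \<in> P" using RR(1) spectrum_points_iff by blast
  then have "openin (spectrum P le \<Theta>) (spectrum_sub P le \<Theta> p)"
    using subbasis_of_openin[OF spectrum_subbasis] by blast
  then show "\<exists>U. openin (spectrum P le \<Theta>) U \<and> R \<in> U \<and> R' \<notin> U"
    using p RR(1) unfolding spectrum_sub_def by blast
qed

lemma spectrum_t1_subbasis:
  "t1_subbasis (spectrum P le \<Theta>) (spectrum_sub P le \<Theta>) P le \<Theta>"
proof
  show "t1_space (spectrum P le \<Theta>)" by (rule spectrum_t1)
  show "subbasis_of (spectrum P le \<Theta>) (spectrum_sub P le \<Theta> ` P)" by (rule spectrum_subbasis)
  show "le p q \<longleftrightarrow> spectrum_sub P le \<Theta> p \<subseteq> spectrum_sub P le \<Theta> q" if "p \<in> P" "q \<in> P" for p q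
    using le_iff_spectrum_sub that by blast
  have "\<Union>(spectrum_sub P le \<Theta> ` C) \<subseteq> topspace (spectrum P le \<Theta>)" for C
    unfolding topspace_spectrum spectrum_sub_def by blast
  then have "C \<in> \<Theta> \<longleftrightarrow>
      C \<subseteq> P \<and> topspace (spectrum P le \<Theta>) \<subseteq> \<Union>(spectrum_sub P le \<Theta> ` C)" for C
    using cover_iff[of C] cover_subset[of C] by (metis subset_antisym order_refl)
  then show "\<Theta> = {C. C \<subseteq> P \<and> topspace (spectrum P le \<Theta>) \<subseteq> \<Union>(spectrum_sub P le \<Theta> ` C)}"
    by (intro set_eqI) simp
qed

lemma spectrum_relatively_compact:
  "p \<in> P \<Longrightarrow> relatively_compactin (spectrum P le \<Theta>) (spectrum_sub P le \<Theta> p)"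
  using t1_subbasis.relatively_compactinI[OF spectrum_t1_subbasis] restriction_finite by blast

lemma spectrum_loc_rel_compact: "loc_rel_compact_space (spectrum P le \<Theta>)"
  using loc_rel_compact_space_subbasis[OF spectrum_t1 spectrum_subbasis]
    spectrum_relatively_compact by blast

end


section \<open>The duality\<close>

theorem theorem6p9:
  fixes P :: "'a set" and le :: "'a \<Rightarrow> 'a \<Rightarrow> bool" and \<Theta> :: "'a set set"
    and X :: "'b topology" and Q :: "'b set set"
  shows
    "(generalised_wallman_poset P le \<Theta> \<longrightarrow>
        loc_rel_compact_space (spectrum P le \<Theta>) \<and>
        t1_space (spectrum P le \<Theta>) \<and>
        subbasis_of (spectrum P le \<Theta>) (spectrum_sub P le \<Theta> ` P) \<and>
        (\<forall>p\<in>P. relatively_compactin (spectrum P le \<Theta>) (spectrum_sub P le \<Theta> p)) \<and>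
        (\<forall>p\<in>P. \<forall>q\<in>P. le p q \<longleftrightarrow> spectrum_sub P le \<Theta> p \<subseteq> spectrum_sub P le \<Theta> q) \<and>
        (\<forall>C. C \<subseteq> P \<longrightarrow>
           (C \<in> \<Theta> \<longleftrightarrow> topspace (spectrum P le \<Theta>) = (\<Union>c\<in>C. spectrum_sub P le \<Theta> c)))) \<and>
     (t1_space X \<and> subbasis_of X Q \<and> (\<forall>U\<in>Q. relatively_compactin X U) \<longrightarrow>
        generalised_wallman_poset Q (\<subseteq>) (covers_of X Q) \<and>
        spectrum Q (\<subseteq>) (covers_of X Q) homeomorphic_space X)"
proof (rule conjI; rule impI)
  assume "generalised_wallman_poset P le \<Theta>"
  then interpret generalised_wallman P le \<Theta> by unfold_locales
  show "loc_rel_compact_space (spectrum P le \<Theta>) \<and>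
        t1_space (spectrum P le \<Theta>) \<and>
        subbasis_of (spectrum P le \<Theta>) (spectrum_sub P le \<Theta> ` P) \<and>
        (\<forall>p\<in>P. relatively_compactin (spectrum P le \<Theta>) (spectrum_sub P le \<Theta> p)) \<and>
        (\<forall>p\<in>P. \<forall>q\<in>P. le p q \<longleftrightarrow> spectrum_sub P le \<Theta> p \<subseteq> spectrum_sub P le \<Theta> q) \<and>
        (\<forall>C. C \<subseteq> P \<longrightarrow>
           (C \<in> \<Theta> \<longleftrightarrow> topspace (spectrum P le \<Theta>) = (\<Union>c\<in>C. spectrum_sub P le \<Theta> c)))"
    using spectrum_loc_rel_compact spectrum_t1 spectrum_subbasis spectrum_relatively_compact
      le_iff_spectrum_sub cover_iff by blast
next
  assume asm: "t1_space X \<and> subbasis_of X Q \<and> (\<forall>U\<in>Q. relatively_compactin X U)"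
  then interpret t1_subbasis X "\<lambda>U. U" Q "(\<subseteq>)" "covers_of X Q"
    by unfold_locales (auto simp: covers_of_def)
  show "generalised_wallman_poset Q (\<subseteq>) (covers_of X Q) \<and>
        spectrum Q (\<subseteq>) (covers_of X Q) homeomorphic_space X"
    using generalised_wallman_posetI spectrum_homeomorphic asm by simp
qed

end
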